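(* Let $\mathcal G_k^{\mathrm{test}}$ be a test graph, and let $\hat\theta=\arg\min_\theta\mathcal L$ be the parameters of the graph neural network that minimize the training objective $\mathcal L(\theta)=\frac1N\sum_{i=1}^N\ell(\mathcal G_i,\theta)$. The impact of upweighting the objective function $\mathcal L$ to $$\mathcal L^{\mathrm{aug}}_{n,m}=\mathcal L+\epsilon_{n,m}\,\ell(\widetilde{\mathcal G}_n^m,\theta),$$ where $\widetilde{\mathcal G}_n^m$ is an augmented graph candidate of the training graph $\mathcal G_n$ and $\epsilon_{n,m}$ is a sufficiently small perturbation parameter, on the model performance on the test graph $\mathcal G_k^{\mathrm{test}}$ is given by $$\frac{d\,\ell(\mathcal G_k^{\mathrm{test}},\hat\theta_{\epsilon_{n,m}})}{d\epsilon_{n,m}}=-\nabla_\theta\ell(\mathcal G_k^{\mathrm{test}},\hat\theta)^\top\,\mathbf H_{\hat\theta}^{-1}\,\nabla_\theta\ell(\widetilde{\mathcal G}_n^m,\hat\theta),$$ where $\hat\theta_{\epsilon_{n,m}}=\arg\min_\theta\mathcal L^{\mathrm{aug}}_{n,m}$ denotes the parameters that minimize the upweighted objective function $\mathcal L^{\mathrm{aug}}_{n,m}$, and $\mathbf H_{\hat\theta}=\nabla^2_\theta\mathcal L(\hat\theta)$ is the Hessian matrix of the loss with respect to the model parameters.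
   Context: $\theta$ is the parameter vector of a graph neural network $f(\cdot,\theta)$ for graph classification, and $\mathcal G_1,\dots,\mathcal G_N$ are the training graphs with labels $y_1,\dots,y_N$. For a graph $\mathcal G$ with label $y$, $\ell(\mathcal G,\theta)$ abbreviates the loss $\ell(f(\mathcal G,\theta),y)$, where $\ell$ is the cross-entropy loss; the paper remarks that the result is valid for any differentiable loss function. An augmented graph candidate $\widetilde{\mathcal G}_n^m$ is a labelled graph produced from $(\mathcal G_n,y_n)$ by a data augmentation procedure; the network with parameters $\hat\theta$ is trained solely on the training set, without the augmented graph. Gradients are column vectors.
   Formalization: Derivative taken at ε=0; per-graph losses are assumed differentiable in θ, ∇L differentiable at θ̂ and the Hessian invertible; added: for small ε the minimizers θ̂_ε stay in a compact set where θ̂ is the only minimizer of L, since otherwise they may escape to infinity and the formula fails. *)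

theory Defs
  imports "HOL-Analysis.Analysis"
begin

text \<open>Graphs, labels and network outputs are arbitrary types: the architecture of the network
  \<open>f\<close> is irrelevant, and \<open>loss\<close> may be the cross-entropy or any other loss for which
  the composite below is differentiable in the parameters.\<close>

definition sample_loss ::
  "('out \<Rightarrow> 'label \<Rightarrow> real) \<Rightarrow> ('graph \<Rightarrow> 'par \<Rightarrow> 'out) \<Rightarrow> 'graph \<times> 'label \<Rightarrow> 'par \<Rightarrow> real" where
  "sample_loss loss f z \<theta> = loss (f (fst z) \<theta>) (snd z)"

definition training_objective ::
  "('out \<Rightarrow> 'label \<Rightarrow> real) \<Rightarrow> ('graph \<Rightarrow> 'par \<Rightarrow> 'out) \<Rightarrow> (nat \<Rightarrow> 'graph \<times> 'label) \<Rightarrow> nat \<Rightarrow> 'par \<Rightarrow> real" where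
  "training_objective loss f D N \<theta> = (1 / real N) * (\<Sum>i = 1..N. sample_loss loss f (D i) \<theta>)"

definition upweighted_objective ::
  "('out \<Rightarrow> 'label \<Rightarrow> real) \<Rightarrow> ('graph \<Rightarrow> 'par \<Rightarrow> 'out) \<Rightarrow> (nat \<Rightarrow> 'graph \<times> 'label) \<Rightarrow> nat \<Rightarrow>
    'graph \<times> 'label \<Rightarrow> real \<Rightarrow> 'par \<Rightarrow> real" where
  "upweighted_objective loss f D N z \<epsilon> \<theta> =
     training_objective loss f D N \<theta> + \<epsilon> * sample_loss loss f z \<theta>"

text \<open>The set of all global minimizers. A training objective may have several of them, so
  ``the'' minimizer is always selected from this set. Intersecting with a compact \<open>K\<close>
  fixes which minimizer is meant and keeps perturbed minimizers from escaping to infinity or jumping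
  to a different one; the minimization itself remains over all parameters.\<close>

definition argmin_set :: "('a \<Rightarrow> real) \<Rightarrow> 'a set" where
  "argmin_set g = {x. is_arg_min g (\<lambda>_. True) x}"

definition gradient :: "('a::real_inner \<Rightarrow> real) \<Rightarrow> 'a \<Rightarrow> 'a" where
  "gradient g x = (THE v. GDERIV g x :> v)"

text \<open>The \<open>(i, j)\<close> entry is \<open>\<partial>\<^sub>j \<partial>\<^sub>i g\<close>; this is meaningful where
  \<open>gradient g\<close> is differentiable.\<close>

definition hessian :: "(real ^ 'p \<Rightarrow> real) \<Rightarrow> real ^ 'p \<Rightarrow> real ^ 'p ^ 'p" where
  "hessian g x = jacobian (gradient g) (at x)"

end

theory Submission
  imports Defs
begin

section \<open>Gradients and inverse matrices\<close>

text \<open>The definite description in \<open>gradient\<close> is justified by Riesz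
  representation: a linear functional is the inner product with the vector of its values on the
  basis, and that vector is unique.\<close>

lemma GDERIV_gradient:
  fixes g :: "'a::euclidean_space \<Rightarrow> real"
  assumes "g differentiable (at x)"
  shows "GDERIV g x :> gradient g x"
proof -
  obtain g' where g': "(g has_derivative g') (at x)"
    using assms by (auto simp: differentiable_def)
  have "linear g'" using g' by (rule has_derivative_linear)
  define v where "v = (\<Sum>b\<in>Basis. g' b *\<^sub>R b)"
  have "g' h = h \<bullet> v" for h
  proof -
    have "g' h = g' (\<Sum>b\<in>Basis. (h \<bullet> b) *\<^sub>R b)" by (simp add: euclidean_representation)
    also have "\<dots> = (\<Sum>b\<in>Basis. (h \<bullet> b) * g' b)"
      by (simp add: linear_sum[OF \<open>linear g'\<close>] linear_cmul[OF \<open>linear g'\<close>])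
    also have "\<dots> = h \<bullet> v"
      by (simp add: v_def inner_sum_right mult.commute)
    finally show ?thesis .
  qed
  then have ex: "GDERIV g x :> v"
    using g' by (metis ext gderiv_def)
  have "w = v" if "GDERIV g x :> w" for w
  proof -
    have "(\<lambda>h. h \<bullet> w) = (\<lambda>h. h \<bullet> v)"
      using has_derivative_unique that ex unfolding gderiv_def by blast
    then have "(w - v) \<bullet> w = (w - v) \<bullet> v" by metis
    then have "(w - v) \<bullet> (w - v) = 0" by (simp add: inner_diff_right)
    then show ?thesis by simp
  qed
  with ex show ?thesis
    unfolding gradient_def by (rule theI)
qed

lemma matrix_inv_right_mult:
  fixes A :: "real ^ 'n ^ 'n"
  assumes "invertible A"
  shows "A *v (matrix_inv A *v x) = x"
proof -
  have "A ** matrix_inv A = mat 1 \<and> matrix_inv A ** A = mat 1"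
    using assms unfolding invertible_def matrix_inv_def by (rule someI_ex)
  then show ?thesis by (simp add: matrix_vector_mul_assoc)
qed

section \<open>Second-order Taylor expansion and symmetry of the second derivative\<close>

text \<open>\<open>G\<close> and \<open>H\<close> are free parameters in the roles of the gradient
  and of its derivative at \<open>a\<close>. The quadratic form sees only the symmetric part of
  \<open>H\<close>; the antisymmetric part reappears in increments of the remainder.\<close>

definition taylor2_remainder ::
  "('a::real_inner \<Rightarrow> real) \<Rightarrow> ('a \<Rightarrow> 'a) \<Rightarrow> ('a \<Rightarrow> 'a) \<Rightarrow> 'a \<Rightarrow> 'a \<Rightarrow> real" where
  "taylor2_remainder L G H a h = L (a + h) - L a - G a \<bullet> h - (h \<bullet> H h) / 2"

text \<open>Mean value theorem for the remainder on the segment from \<open>h\<close> to \<open>h + k\<close>. Its derivative in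
  direction \<open>k\<close> at \<open>h + s k\<close> is, up to a small error, the alternating part of \<open>H\<close> evaluated at
  \<open>(h + s k, k)\<close>, which does not depend on \<open>s\<close>.\<close>

lemma taylor2_remainder_increment:
  fixes L :: "'a::real_inner \<Rightarrow> real"
  assumes L: "\<And>x. GDERIV L x :> G x" and G: "(G has_derivative H) (at a)" and "e > 0"
  obtains d where "d > 0"
    "\<And>h k. \<lbrakk>norm h < d; norm k < d\<rbrakk> \<Longrightarrow>
      \<bar>taylor2_remainder L G H a (h + k) - taylor2_remainder L G H a h
         - (H h \<bullet> k - h \<bullet> H k) / 2\<bar> \<le> e * (norm h + norm k) * norm k"
proof -
  interpret H: bounded_linear H using G by (rule has_derivative_bounded_linear)
  obtain d where d: "d > 0"
    and dd: "\<And>y. norm (y - a) < d \<Longrightarrow> norm (G y - G a - H (y - a)) \<le> e * norm (y - a)"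
    using G \<open>e > 0\<close> unfolding has_derivative_at_alt by blast
  show thesis
  proof (rule that)
    \<comment> \<open>Halving keeps the whole segment from \<open>h\<close> to \<open>h + k\<close>
      inside the ball of radius \<open>d\<close>.\<close>
    show "d / 2 > 0" using d by simp
    fix h k :: 'a
    assume h: "norm h < d / 2" and k: "norm k < d / 2"
    define R where "R s = taylor2_remainder L G H a (h + s *\<^sub>R k)" for s
    \<comment> \<open>The derivative of \<open>R\<close>. Symmetry of \<open>H\<close> is not yet
      available, so the product rule leaves the quadratic term in both orders.\<close>
    define R' where "R' s = (G (a + (h + s *\<^sub>R k)) - G a) \<bullet> k
        - (k \<bullet> H (h + s *\<^sub>R k) + (h + s *\<^sub>R k) \<bullet> H k) / 2" for s
    have L': "(L has_derivative (\<lambda>v. v \<bullet> G x)) (at x)" for x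
      using L by (simp add: gderiv_def)
    have "(R has_derivative (\<lambda>t. t * R' s)) (at s)" for s
    proof -
      have p: "((\<lambda>s. a + (h + s *\<^sub>R k)) has_derivative (\<lambda>t. t *\<^sub>R k)) (at s)"
        by (auto intro!: derivative_eq_intros)
      have L1: "((\<lambda>s. L (a + (h + s *\<^sub>R k))) has_derivative (\<lambda>t. t *\<^sub>R k \<bullet> G (a + (h + s *\<^sub>R k)))) (at s)"
        by (rule has_derivative_compose[OF p L'])
      have H1: "((\<lambda>s. H (h + s *\<^sub>R k)) has_derivative (\<lambda>t. H (t *\<^sub>R k))) (at s)"
        by (rule H.has_derivative) (auto intro!: derivative_eq_intros)
      have p0: "((\<lambda>s. h + s *\<^sub>R k) has_derivative (\<lambda>t. t *\<^sub>R k)) (at s)"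
        by (auto intro!: derivative_eq_intros)
      have Q: "((\<lambda>s. ((h + s *\<^sub>R k) \<bullet> H (h + s *\<^sub>R k)) / 2) has_derivative
          (\<lambda>t. ((h + s *\<^sub>R k) \<bullet> H (t *\<^sub>R k) + (t *\<^sub>R k) \<bullet> H (h + s *\<^sub>R k)) / 2)) (at s)"
        by (intro bounded_linear.has_derivative[OF bounded_linear_divide] has_derivative_inner p0 H1)
      have P: "((\<lambda>s. G a \<bullet> (h + s *\<^sub>R k)) has_derivative (\<lambda>t. G a \<bullet> (t *\<^sub>R k))) (at s)"
        by (intro has_derivative_inner_right p0)
      have "(R has_derivative (\<lambda>t. (t *\<^sub>R k \<bullet> G (a + (h + s *\<^sub>R k)) - 0) - G a \<bullet> (t *\<^sub>R k) -
          ((h + s *\<^sub>R k) \<bullet> H (t *\<^sub>R k) + (t *\<^sub>R k) \<bullet> H (h + s *\<^sub>R k)) / 2)) (at s)"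
        unfolding R_def taylor2_remainder_def
        by (intro has_derivative_diff has_derivative_const L1 P Q)
      moreover have "(\<lambda>t. (t *\<^sub>R k \<bullet> G (a + (h + s *\<^sub>R k)) - 0) - G a \<bullet> (t *\<^sub>R k) -
          ((h + s *\<^sub>R k) \<bullet> H (t *\<^sub>R k) + (t *\<^sub>R k) \<bullet> H (h + s *\<^sub>R k)) / 2) = (\<lambda>t. t * R' s)"
        by (rule ext) (simp add: R'_def H.scaleR inner_diff_left inner_commute[of k "G _"] field_simps)
      ultimately show ?thesis by simp
    qed
    then have "\<exists>s\<in>{0..1}. R 1 - R 0 = (1 - 0) * R' s"
      by (intro mvt_very_simple) (auto intro: has_derivative_at_withinI)
    then obtain s where s: "0 \<le> s" "s \<le> 1" and eq: "R 1 - R 0 = R' s" by auto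
    define u where "u = h + s *\<^sub>R k"
    have "norm u \<le> norm h + s * norm k"
      unfolding u_def using s by (metis abs_of_nonneg norm_scaleR norm_triangle_ineq)
    also have "\<dots> \<le> norm h + norm k" using s by (simp add: mult_left_le_one_le)
    finally have u: "norm u \<le> norm h + norm k" .
    have "R' s - (H h \<bullet> k - h \<bullet> H k) / 2 = (G (a + u) - G a - H u) \<bullet> k"
      unfolding R'_def u_def
      by (simp add: H.scaleR H.add inner_simps inner_commute field_simps)
    also have "\<bar>\<dots>\<bar> \<le> norm (G (a + u) - G a - H u) * norm k"
      by (rule Cauchy_Schwarz_ineq2)
    also have "\<dots> \<le> (e * norm u) * norm k"
      using dd[of "a + u"] u h k by (intro mult_right_mono) auto
    also have "\<dots> \<le> e * (norm h + norm k) * norm k"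
      using u \<open>e > 0\<close> by (intro mult_right_mono mult_left_mono) auto
    finally show "\<bar>taylor2_remainder L G H a (h + k) - taylor2_remainder L G H a h
         - (H h \<bullet> k - h \<bullet> H k) / 2\<bar> \<le> e * (norm h + norm k) * norm k"
      using eq by (simp add: R_def)
  qed
qed

text \<open>The increment estimate started at zero, where the remainder and the bilinear term both
  vanish. It is Taylor's formula with error of order o(\<open>(norm h)\<^sup>2\<close>), obtained
  from a gradient differentiable at the single point \<open>a\<close>.\<close>

lemma taylor2_remainder_bound:
  fixes L :: "'a::real_inner \<Rightarrow> real"
  assumes "\<And>x. GDERIV L x :> G x" "(G has_derivative H) (at a)" "e > 0"
  obtains d where "d > 0"
    "\<And>h. norm h < d \<Longrightarrow> \<bar>taylor2_remainder L G H a h\<bar> \<le> e * (norm h)\<^sup>2"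
proof -
  interpret H: bounded_linear H using assms(2) by (rule has_derivative_bounded_linear)
  obtain d where "d > 0" and d: "\<And>h k. \<lbrakk>norm h < d; norm k < d\<rbrakk> \<Longrightarrow>
      \<bar>taylor2_remainder L G H a (h + k) - taylor2_remainder L G H a h
         - (H h \<bullet> k - h \<bullet> H k) / 2\<bar> \<le> e * (norm h + norm k) * norm k"
    by (rule taylor2_remainder_increment[OF assms]) blast
  have "\<bar>taylor2_remainder L G H a h\<bar> \<le> e * (norm h)\<^sup>2" if "norm h < d" for h
    using d[of 0 h] that \<open>d > 0\<close>
    by (simp add: taylor2_remainder_def H.zero power2_eq_square mult.assoc)
  with \<open>d > 0\<close> show thesis by (rule that)
qed

text \<open>The remainders in the increment estimate are all of second order, so the bilinear term in it
  must vanish.\<close>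

lemma second_derivative_symmetric:
  fixes L :: "'a::real_inner \<Rightarrow> real"
  assumes L: "\<And>x. GDERIV L x :> G x" and G: "(G has_derivative H) (at a)"
  shows "H x \<bullet> y = x \<bullet> H y"
proof -
  interpret H: bounded_linear H using G by (rule has_derivative_bounded_linear)
  let ?R = "taylor2_remainder L G H a"
  define b where "b = (H x \<bullet> y - x \<bullet> H y) / 2"
  \<comment> \<open>One bound for \<open>x\<close>, \<open>y\<close> and \<open>x + y\<close>; the
    summand 1 makes it positive when both vectors are zero.\<close>
  define M where "M = norm x + norm y + 1"
  have "M > 0" unfolding M_def by (smt (verit) norm_ge_zero)
  \<comment> \<open>The factor 3 counts the increment error and the remainders at the two ends of
    the increment. Since \<open>M\<close> does not depend on \<open>e\<close>, letting
    \<open>e\<close> tend to zero forces \<open>b = 0\<close>.\<close>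
  have bound: "\<bar>b\<bar> \<le> 3 * M\<^sup>2 * e" if "e > 0" for e :: real
  proof -
    obtain d1 where "d1 > 0" and d1: "\<And>h k. \<lbrakk>norm h < d1; norm k < d1\<rbrakk> \<Longrightarrow>
      \<bar>?R (h + k) - ?R h - (H h \<bullet> k - h \<bullet> H k) / 2\<bar> \<le> e * (norm h + norm k) * norm k"
      by (rule taylor2_remainder_increment[OF L G \<open>e > 0\<close>]) blast
    obtain d2 where "d2 > 0" and d2: "\<And>h. norm h < d2 \<Longrightarrow> \<bar>?R h\<bar> \<le> e * (norm h)\<^sup>2"
      by (rule taylor2_remainder_bound[OF L G \<open>e > 0\<close>]) blast
    \<comment> \<open>This scale makes \<open>t * M\<close> half the smaller radius. Both sides of
      the final estimate are quadratic in \<open>t\<close>, so the scale cancels.\<close>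
    define t where "t = min d1 d2 / (2 * M)"
    have "t > 0" using \<open>d1 > 0\<close> \<open>d2 > 0\<close> \<open>M > 0\<close> by (simp add: t_def)
    have "t * M < min d1 d2"
      using \<open>d1 > 0\<close> \<open>d2 > 0\<close> \<open>M > 0\<close> by (auto simp: t_def)
    have small: "norm (t *\<^sub>R z) < d1" "norm (t *\<^sub>R z) < d2" "(norm (t *\<^sub>R z))\<^sup>2 \<le> t\<^sup>2 * M\<^sup>2"
      if "norm z \<le> M" for z
    proof -
      have "norm (t *\<^sub>R z) \<le> t * M" using that \<open>t > 0\<close> by simp
      then show "norm (t *\<^sub>R z) < d1" "norm (t *\<^sub>R z) < d2" "(norm (t *\<^sub>R z))\<^sup>2 \<le> t\<^sup>2 * M\<^sup>2"
        using \<open>t * M < min d1 d2\<close> power_mono[of "norm (t *\<^sub>R z)" "t * M" 2]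
        by (auto simp: power_mult_distrib)
    qed
    have M: "norm x \<le> M" "norm y \<le> M" "norm (x + y) \<le> M" "norm x + norm y \<le> M"
      using norm_triangle_ineq[of x y] norm_ge_zero[of x] norm_ge_zero[of y]
      by (auto simp: M_def)
    have R: "\<bar>?R (t *\<^sub>R z)\<bar> \<le> e * (t\<^sup>2 * M\<^sup>2)" if "norm z \<le> M" for z
      using d2[of "t *\<^sub>R z"] small[OF that] \<open>e > 0\<close> by (meson mult_left_mono order_trans less_imp_le)
    have "e * (norm (t *\<^sub>R x) + norm (t *\<^sub>R y)) * norm (t *\<^sub>R y)
        = e * t\<^sup>2 * ((norm x + norm y) * norm y)"
      using \<open>t > 0\<close> by (simp add: power2_eq_square algebra_simps)
    also have "\<dots> \<le> e * t\<^sup>2 * (M * M)"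
      using M \<open>e > 0\<close> \<open>M > 0\<close> by (intro mult_left_mono mult_mono) auto
    finally have "\<bar>?R (t *\<^sub>R x + t *\<^sub>R y) - ?R (t *\<^sub>R x)
        - (H (t *\<^sub>R x) \<bullet> (t *\<^sub>R y) - (t *\<^sub>R x) \<bullet> H (t *\<^sub>R y)) / 2\<bar> \<le> e * (t\<^sup>2 * M\<^sup>2)"
      using d1[OF small(1)[OF M(1)] small(1)[OF M(2)]] by (simp only: power2_eq_square mult.assoc)
    moreover have "(H (t *\<^sub>R x) \<bullet> (t *\<^sub>R y) - (t *\<^sub>R x) \<bullet> H (t *\<^sub>R y)) / 2 = t\<^sup>2 * b"
      by (simp add: H.scaleR b_def power2_eq_square field_simps)
    ultimately have "\<bar>t\<^sup>2 * b\<bar> \<le> 3 * (e * (t\<^sup>2 * M\<^sup>2))"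
      using R[OF M(1)] R[OF M(3)] by (auto simp: scaleR_add_right)
    then have "t\<^sup>2 * \<bar>b\<bar> \<le> t\<^sup>2 * (3 * M\<^sup>2 * e)"
      by (simp add: abs_mult algebra_simps)
    then show ?thesis using \<open>t > 0\<close> by simp
  qed
  have "\<bar>b\<bar> \<le> 0"
  proof (rule field_le_epsilon)
    fix e :: real assume "e > 0"
    then show "\<bar>b\<bar> \<le> 0 + e"
      using bound[of "e / (3 * M\<^sup>2)"] \<open>M > 0\<close> by simp
  qed
  then show ?thesis by (simp add: b_def)
qed

section \<open>Second-order conditions at a minimum and coercivity\<close>

text \<open>Once the gradient vanishes, the nonnegative increment of \<open>L\<close> along
  \<open>t *\<^sub>R h\<close> is half of \<open>t\<^sup>2 * (h \<bullet> H h)\<close> up to a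
  smaller error; dividing by \<open>t\<^sup>2\<close> leaves the quadratic form.\<close>

lemma second_derivative_nonneg_at_minimum:
  fixes L :: "'a::real_inner \<Rightarrow> real"
  assumes L: "\<And>x. GDERIV L x :> G x" and G: "(G has_derivative H) (at a)"
    and min: "\<And>x. L a \<le> L x"
  shows "G a = 0" "0 \<le> h \<bullet> H h"
proof -
  interpret H: bounded_linear H using G by (rule has_derivative_bounded_linear)
  have "(\<lambda>v. v \<bullet> G a) = (\<lambda>v. 0)"
    using L[of a] unfolding gderiv_def
    by (rule has_derivative_local_min) (simp add: min)
  then have "G a \<bullet> G a = 0" by metis
  then show Ga: "G a = 0" by simp
  show "0 \<le> h \<bullet> H h"
  proof (rule field_le_epsilon)
    fix e :: real assume "e > 0"
    \<comment> \<open>Chosen so that the remainder, after division by \<open>t * t\<close>, is at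
      most \<open>e / 2\<close>, which matches the factor 1/2 of the quadratic form.\<close>
    define M where "M = 2 * ((norm h)\<^sup>2 + 1)"
    have "M > 0" by (simp add: M_def add_nonneg_pos)
    obtain d where "d > 0"
      and d: "\<And>h. norm h < d \<Longrightarrow> \<bar>taylor2_remainder L G H a h\<bar> \<le> (e / M) * (norm h)\<^sup>2"
      using taylor2_remainder_bound[OF L G] \<open>e > 0\<close> \<open>M > 0\<close> by (metis divide_pos_pos)
    define t where "t = d / (2 * (norm h + 1))"
    have "t > 0" using \<open>d > 0\<close> by (simp add: t_def add_nonneg_pos)
    have "norm h + 1 \<noteq> 0" using norm_ge_zero[of h] by linarith
    then have "t * (norm h + 1) = d / 2"
      by (simp add: t_def del: distrib_left_numeral)
    then have "t * (norm h + 1) < d" using \<open>d > 0\<close> by simp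
    then have "norm (t *\<^sub>R h) < d" using \<open>t > 0\<close> by (simp add: algebra_simps)
    \<comment> \<open>Minimality bounds the remainder below by minus half the quadratic form, while
      \<open>d\<close> bounds it above.\<close>
    from d[OF this] have "- ((t * t) * (h \<bullet> H h)) / 2 \<le> (e / M) * (norm (t *\<^sub>R h))\<^sup>2"
      using min[of "a + t *\<^sub>R h"] Ga by (simp add: taylor2_remainder_def H.scaleR mult.assoc)
    also have "\<dots> = (t * t) * (e / M * (norm h)\<^sup>2)" using \<open>t > 0\<close> by (simp add: power2_eq_square)
    finally have "(t * t) * (- (h \<bullet> H h) / 2) \<le> (t * t) * (e / M * (norm h)\<^sup>2)" by simp
    then have "- (h \<bullet> H h) / 2 \<le> e / M * (norm h)\<^sup>2"
      by (rule mult_left_le_imp_le) (use \<open>t > 0\<close> in simp)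
    also have "\<dots> \<le> e / 2"
    proof -
      have "(norm h)\<^sup>2 / M \<le> 1 / 2" using \<open>M > 0\<close> by (simp add: M_def field_simps)
      then have "e * ((norm h)\<^sup>2 / M) \<le> e * (1 / 2)" using \<open>e > 0\<close> by (intro mult_left_mono) auto
      then show ?thesis by simp
    qed
    finally show "0 \<le> h \<bullet> H h + e" by simp
  qed
qed

text \<open>An isotropic vector of a symmetric positive semidefinite form lies in its kernel, so
  injectivity makes the form positive definite. Its minimum on the compact unit sphere is then a
  uniform constant, which homogeneity extends to all vectors.\<close>

lemma coercive_of_psd_inj:
  fixes H :: "'a::euclidean_space \<Rightarrow> 'a"
  assumes H: "linear H" and sym: "\<And>x y. H x \<bullet> y = x \<bullet> H y"
    and psd: "\<And>h. 0 \<le> h \<bullet> H h" and inj: "\<And>h. H h = 0 \<Longrightarrow> h = 0"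
  obtains c where "c > 0" "\<And>h. c * (norm h)\<^sup>2 \<le> h \<bullet> H h"
proof -
  have pos: "0 < h \<bullet> H h" if "h \<noteq> 0" for h
  proof (rule ccontr)
    assume "\<not> 0 < h \<bullet> H h"
    then have 0: "h \<bullet> H h = 0" using psd[of h] by simp
    define k where "k = H h"
    \<comment> \<open>Moving from the isotropic \<open>h\<close> in direction \<open>- k\<close>
      changes the form by \<open>- 2 * t * (k \<bullet> k)\<close> to first order; as the form
      cannot become negative, small \<open>t\<close> forces \<open>k = 0\<close>.\<close>
    have "2 * (k \<bullet> k) \<le> t * (k \<bullet> H k)" if "t > 0" for t :: real
    proof -
      have "0 \<le> (h - t *\<^sub>R k) \<bullet> H (h - t *\<^sub>R k)" by (rule psd)
      also have "\<dots> = t * (t * (k \<bullet> H k) - 2 * (k \<bullet> k))"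
        using 0 sym[of h k] by (simp add: linear_diff[OF H] linear_cmul[OF H] inner_simps
            k_def inner_commute algebra_simps)
      finally show ?thesis using that by (simp add: zero_le_mult_iff)
    qed
    then have "2 * (k \<bullet> k) \<le> 0 + e" if "e > 0" for e :: real
    proof -
      \<comment> \<open>The step size \<open>t = e / (k \<bullet> H k + 1)\<close>, with the 1
        guarding against a zero denominator.\<close>
      have "2 * (k \<bullet> k) \<le> e / (k \<bullet> H k + 1) * (k \<bullet> H k)"
        using psd[of k] that by (intro \<open>\<And>t. t > 0 \<Longrightarrow> _\<close>) (simp add: add_nonneg_pos)
      also have "\<dots> \<le> e" using psd[of k] that by (simp add: field_simps add_nonneg_pos)
      finally show ?thesis by simp
    qed
    then have "2 * (k \<bullet> k) \<le> 0" by (rule field_le_epsilon)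
    then have "k = 0" using inner_ge_zero[of k] by (metis inner_gt_zero_iff mult_le_0_iff not_less not_numeral_le_zero)
    with inj \<open>h \<noteq> 0\<close> show False by (simp add: k_def)
  qed
  have cont: "continuous_on (sphere 0 1) (\<lambda>h. h \<bullet> H h)"
    using H by (intro continuous_intros linear_continuous_on) (simp add: linear_conv_bounded_linear)
  obtain b :: 'a where "b \<in> Basis" using nonempty_Basis by blast
  then have "sphere (0::'a) 1 \<noteq> {}" by (auto intro!: exI[of _ b])
  then obtain u where u: "u \<in> sphere 0 1" and min: "\<And>h. h \<in> sphere 0 1 \<Longrightarrow> u \<bullet> H u \<le> h \<bullet> H h"
    using continuous_attains_inf[OF compact_sphere _ cont] by blast
  show thesis
  proof (rule that)
    show "0 < u \<bullet> H u" using u by (intro pos) auto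
    fix h :: 'a
    show "u \<bullet> H u * (norm h)\<^sup>2 \<le> h \<bullet> H h"
    proof (cases "h = 0")
      case False
      have "u \<bullet> H u \<le> (h /\<^sub>R norm h) \<bullet> H (h /\<^sub>R norm h)" using False by (intro min) auto
      also have "\<dots> = (h \<bullet> H h) / (norm h)\<^sup>2"
        by (simp add: linear_cmul[OF H] power2_eq_square field_simps)
      finally show ?thesis using False by (simp add: field_simps)
    qed (use psd in auto)
  qed
qed

section \<open>Convergence and differentiability of perturbed minimizers\<close>

text \<open>On the part of \<open>K\<close> away from \<open>a\<close>, compactness and uniqueness
  leave a positive gap above \<open>L a\<close>. The perturbation is uniformly small on
  \<open>K\<close> and cannot bridge this gap, so the perturbed minimizers must lie near
  \<open>a\<close>.\<close>

lemma perturbed_minimizer_tendsto: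
  fixes L l :: "'a::metric_space \<Rightarrow> real"
  assumes L: "continuous_on K L" and l: "continuous_on K l" and K: "compact K"
    and unique: "argmin_set L \<inter> K = {a}"
    and p: "\<forall>\<^sub>F \<epsilon> in F. p \<epsilon> \<in> argmin_set (\<lambda>x. L x + \<epsilon> * l x) \<inter> K"
    and F: "((\<lambda>\<epsilon>. \<epsilon>) \<longlongrightarrow> 0) F"
  shows "(p \<longlongrightarrow> a) F"
proof (rule tendstoI)
  fix r :: real assume "r > 0"
  have "a \<in> K" and min: "\<And>x. L a \<le> L x"
    using unique by (auto simp: argmin_set_def is_arg_min_linorder)
  have opt: "L (p \<epsilon>) + \<epsilon> * l (p \<epsilon>) \<le> L a + \<epsilon> * l a" "p \<epsilon> \<in> K"
    if "p \<epsilon> \<in> argmin_set (\<lambda>x. L x + \<epsilon> * l x) \<inter> K" for \<epsilon>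
    using that by (auto simp: argmin_set_def is_arg_min_linorder)
  show "\<forall>\<^sub>F \<epsilon> in F. dist (p \<epsilon>) a < r"
  proof (cases "K - ball a r = {}")
    case True
    show ?thesis
      using p by eventually_elim (use True opt(2) in \<open>auto simp: dist_commute\<close>)
  next
    case False
    have "compact (K - ball a r)" using K by (intro compact_diff) auto
    moreover have "continuous_on (K - ball a r) L" using L by (rule continuous_on_subset) auto
    ultimately obtain u where u: "u \<in> K - ball a r" and umin: "\<And>x. x \<in> K - ball a r \<Longrightarrow> L u \<le> L x"
      using continuous_attains_inf False by metis
    have "u \<noteq> a" "u \<in> K" using u \<open>r > 0\<close> by auto
    then have "u \<notin> argmin_set L" using unique by blast
    \<comment> \<open>Equality would make \<open>u\<close> a second global minimizer in
      \<open>K\<close>.\<close>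
    then have gap: "L a < L u"
      using min by (force simp: argmin_set_def is_arg_min_linorder not_le intro: le_less_trans)
    have "bounded (l ` K)" using K l by (intro compact_imp_bounded compact_continuous_image)
    then obtain M where M: "M > 0" "\<And>x. x \<in> K \<Longrightarrow> \<bar>l x\<bar> \<le> M"
      unfolding bounded_pos by auto
    \<comment> \<open>Two values of \<open>l\<close> on \<open>K\<close> differ by at most
      \<open>2 * M\<close>, so below this threshold the perturbation gains less than the
      gap.\<close>
    have "\<forall>\<^sub>F \<epsilon> in F. dist \<epsilon> 0 < (L u - L a) / (2 * M)"
      using F gap \<open>M > 0\<close> by (intro tendstoD) auto
    with p show ?thesis
    proof eventually_elim
      case (elim \<epsilon>)
      have "L (p \<epsilon>) \<le> L a + \<epsilon> * (l a - l (p \<epsilon>))"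
        using opt(1)[OF elim(1)] by (simp add: algebra_simps)
      also have "\<epsilon> * (l a - l (p \<epsilon>)) \<le> \<bar>\<epsilon>\<bar> * \<bar>l a - l (p \<epsilon>)\<bar>"
        by (metis abs_ge_self abs_mult)
      also have "\<dots> \<le> \<bar>\<epsilon>\<bar> * (2 * M)"
        using M(2)[OF \<open>a \<in> K\<close>] M(2)[OF opt(2)[OF elim(1)]] by (intro mult_left_mono) auto
      also have "\<dots> < L u - L a"
        using elim(2) \<open>M > 0\<close> by (simp add: dist_real_def pos_less_divide_eq)
      finally have "L (p \<epsilon>) < L u" by simp
      then have "p \<epsilon> \<notin> K - ball a r" using umin by fastforce
      then show ?case using opt(2)[OF elim(1)] by (auto simp: dist_commute)
    qed
  qed
qed

text \<open>The gradient of \<open>l\<close> need not be continuous, so the first-order condition at \<open>p \<epsilon>\<close> is of no use.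
  Instead \<open>p \<epsilon>\<close> is compared with two competitors: \<open>a\<close> gives \<open>p \<epsilon> - a = O(\<epsilon>)\<close>, and
  \<open>a - \<epsilon> w\<close>, the exact minimizer of the quadratic model, gives \<open>p \<epsilon> - a + \<epsilon> w = o(\<epsilon>)\<close>.\<close>

lemma perturbed_minimizer_has_derivative:
  fixes L l :: "'a::euclidean_space \<Rightarrow> real"
  assumes L: "\<And>x. GDERIV L x :> G x" and G: "(G has_derivative H) (at a)"
    and inj: "\<And>h. H h = 0 \<Longrightarrow> h = 0" and min: "\<And>x. L a \<le> L x"
    and l: "GDERIV l a :> g" and w: "H w = g"
    and p0: "p 0 = a" and p: "(p \<longlongrightarrow> a) (at 0)"
    and opt: "\<forall>\<^sub>F \<epsilon> in at 0. \<forall>x. L (p \<epsilon>) + \<epsilon> * l (p \<epsilon>) \<le> L x + \<epsilon> * l x"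
  shows "(p has_vector_derivative - w) (at 0)"
proof -
  interpret H: bounded_linear H using G by (rule has_derivative_bounded_linear)
  have sym: "H x \<bullet> y = x \<bullet> H y" for x y by (rule second_derivative_symmetric[OF L G])
  have Ga: "G a = 0" and psd: "\<And>h. 0 \<le> h \<bullet> H h"
    using second_derivative_nonneg_at_minimum[OF L G min] by auto
  obtain c where "c > 0" and c: "\<And>h. c * (norm h)\<^sup>2 \<le> h \<bullet> H h"
    by (rule coercive_of_psd_inj[OF H.linear sym psd inj]) auto
  have "\<exists>d>0. \<forall>\<epsilon>. \<bar>\<epsilon>\<bar> < d \<longrightarrow> norm (p \<epsilon> - a - \<epsilon> *\<^sub>R (- w)) \<le> \<eta> * \<bar>\<epsilon>\<bar>"
    if "\<eta> > 0" for \<eta> :: real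
  proof -
    \<comment> \<open>\<open>C\<close> is the rate constant from the comparison with
      \<open>a\<close>. \<open>M - 1\<close> collects the coefficients of the four error terms in
      the comparison with \<open>a - \<epsilon> w\<close>. The two bounds on \<open>e\<close> serve
      these comparisons in turn.\<close>
    define C where "C = (4 * norm g + c) / c"
    define M where "M = C\<^sup>2 + C + (norm w)\<^sup>2 + norm w + 1"
    define e where "e = min (c / 4) (c * \<eta>\<^sup>2 / (2 * M))"
    have "C \<ge> 0" using \<open>c > 0\<close> by (simp add: C_def)
    then have "M > 0" by (simp add: M_def add_nonneg_pos)
    then have "e > 0" using \<open>c > 0\<close> \<open>\<eta> > 0\<close> by (simp add: e_def)
    have e: "e \<le> c / 4" "e * M \<le> c * \<eta>\<^sup>2 / 2"
    proof -
      show "e \<le> c / 4" by (simp add: e_def)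
      have "e * M \<le> c * \<eta>\<^sup>2 / (2 * M) * M"
        using \<open>M > 0\<close> by (intro mult_right_mono) (auto simp: e_def)
      then show "e * M \<le> c * \<eta>\<^sup>2 / 2" using \<open>M > 0\<close> by simp
    qed
    obtain d1 where "d1 > 0"
      and d1: "\<And>h. norm h < d1 \<Longrightarrow> \<bar>taylor2_remainder L G H a h\<bar> \<le> e * (norm h)\<^sup>2"
      by (rule taylor2_remainder_bound[OF L G \<open>e > 0\<close>]) blast
    obtain d2 where "d2 > 0"
      and d2: "\<And>y. norm (y - a) < d2 \<Longrightarrow> norm (l y - l a - (y - a) \<bullet> g) \<le> e * norm (y - a)"
      using l \<open>e > 0\<close> unfolding gderiv_def has_derivative_at_alt by blast
    define r where "r = min d1 d2"
    have "r > 0" using \<open>d1 > 0\<close> \<open>d2 > 0\<close> by (simp add: r_def)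
    have Lh: "\<bar>L (a + h) - L a - (h \<bullet> H h) / 2\<bar> \<le> e * (norm h)\<^sup>2"
      and lh: "\<bar>l (a + h) - l a - h \<bullet> g\<bar> \<le> e * norm h" if "norm h < r" for h
      using d1[of h] d2[of "a + h"] that by (auto simp: r_def taylor2_remainder_def Ga)
    have "\<forall>\<^sub>F \<epsilon> in at 0. dist (p \<epsilon>) a < r \<and> (\<forall>x. L (p \<epsilon>) + \<epsilon> * l (p \<epsilon>) \<le> L x + \<epsilon> * l x)"
      using tendstoD[OF p \<open>r > 0\<close>] opt by (rule eventually_conj)
    then obtain d where "d > 0" and d: "\<And>\<epsilon>. \<lbrakk>\<epsilon> \<noteq> 0; \<bar>\<epsilon>\<bar> < d\<rbrakk> \<Longrightarrow>
        dist (p \<epsilon>) a < r \<and> (\<forall>x. L (p \<epsilon>) + \<epsilon> * l (p \<epsilon>) \<le> L x + \<epsilon> * l x)"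
      unfolding eventually_at by auto
    \<comment> \<open>The second bound keeps the competitor \<open>a - \<epsilon> w\<close> within
      radius \<open>r\<close> of \<open>a\<close>.\<close>
    define d' where "d' = min d (r / (norm w + 1))"
    have nw: "norm w + 1 > 0" by (simp add: add_nonneg_pos)
    have "d' > 0" using \<open>d > 0\<close> \<open>r > 0\<close> nw by (simp add: d'_def)
    moreover have "norm (p \<epsilon> - a - \<epsilon> *\<^sub>R (- w)) \<le> \<eta> * \<bar>\<epsilon>\<bar>" if "\<bar>\<epsilon>\<bar> < d'" for \<epsilon>
    proof (cases "\<epsilon> = 0")
      case True
      then show ?thesis by (simp add: p0)
    next
      case False
      define h where "h = p \<epsilon> - a"
      define k where "k = \<epsilon> *\<^sub>R (- w)"
      have "norm h < r" and
        opt': "L (a + h) + \<epsilon> * l (a + h) \<le> L x + \<epsilon> * l x" for x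
        using d[OF False] that by (auto simp: h_def d'_def dist_norm)
      have "\<bar>\<epsilon>\<bar> * (norm w + 1) < r" using that nw by (simp add: d'_def pos_less_divide_eq)
      then have "norm k < r" by (simp add: k_def algebra_simps)
      have nk: "norm k = \<bar>\<epsilon>\<bar> * norm w" by (simp add: k_def)
      have err: "\<bar>\<epsilon> * (l (a + v) - l a) - \<epsilon> * (v \<bullet> g)\<bar> \<le> \<bar>\<epsilon>\<bar> * (e * norm v)" if "norm v < r" for v
        using mult_left_mono[OF lh[OF that] abs_ge_zero[of \<epsilon>]]
        by (simp add: abs_mult[symmetric] right_diff_distrib)
      \<comment> \<open>Coercivity contributes \<open>c / 2 * (norm h)\<^sup>2\<close>, and the
        remainder consumes at most half of it since \<open>e \<le> c / 4\<close>. The perturbation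
        is linear in \<open>norm h\<close>, so one factor cancels.\<close>
      have h_small: "norm h \<le> C * \<bar>\<epsilon>\<bar>"
      proof (cases "h = 0")
        case True
        then show ?thesis using \<open>C \<ge> 0\<close> by simp
      next
        case False
        have "\<bar>\<epsilon> * (h \<bullet> g)\<bar> \<le> \<bar>\<epsilon>\<bar> * (norm h * norm g)"
          by (simp add: abs_mult mult_left_mono Cauchy_Schwarz_ineq2)
        moreover have "e * (norm h)\<^sup>2 \<le> c / 4 * (norm h)\<^sup>2"
          "\<bar>\<epsilon>\<bar> * (e * norm h) \<le> \<bar>\<epsilon>\<bar> * (c / 4 * norm h)"
          using e(1) by (intro mult_left_mono mult_right_mono; simp)+
        ultimately have "c / 4 * (norm h)\<^sup>2 \<le> \<bar>\<epsilon>\<bar> * (norm h * norm g) + \<bar>\<epsilon>\<bar> * (c / 4 * norm h)"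
          using Lh[OF \<open>norm h < r\<close>] err[OF \<open>norm h < r\<close>] opt'[of a] c[of h]
          by (simp add: right_diff_distrib abs_le_iff)
        then have "norm h * (c * norm h) \<le> norm h * (\<bar>\<epsilon>\<bar> * (4 * norm g + c))"
          by (simp add: power2_eq_square algebra_simps)
        then have "c * norm h \<le> \<bar>\<epsilon>\<bar> * (4 * norm g + c)"
          using False by simp
        then show ?thesis using \<open>c > 0\<close> by (simp add: C_def field_simps)
      qed
      \<comment> \<open>Stationarity of \<open>k\<close> for the model
        \<open>(v \<bullet> H v) / 2 + \<epsilon> * (v \<bullet> g)\<close>.\<close>
      have Hk: "H k = - (\<epsilon> *\<^sub>R g)" by (simp add: k_def H.scaleR H.neg w)
      have "k \<bullet> H h = h \<bullet> H k" using sym[of k h] by (simp add: inner_commute)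
      \<comment> \<open>Completing the square: stationarity and symmetry turn the excess of the
        model at \<open>h\<close> over its value at \<open>k\<close> into a pure quadratic in
        \<open>h - k\<close>.\<close>
      then have "((h - k) \<bullet> H (h - k)) / 2
          = ((h \<bullet> H h) / 2 + \<epsilon> * (h \<bullet> g)) - ((k \<bullet> H k) / 2 + \<epsilon> * (k \<bullet> g))"
        by (simp add: H.diff Hk inner_simps field_simps)
      \<comment> \<open>The true objective at \<open>a + h\<close> does not exceed that at
        \<open>a + k\<close>, so the model excess is at most the approximation errors of
        \<open>L\<close> and \<open>l\<close> at both points.\<close>
      also have "\<dots> \<le> e * (norm h)\<^sup>2 + \<bar>\<epsilon>\<bar> * (e * norm h) + (e * (norm k)\<^sup>2 + \<bar>\<epsilon>\<bar> * (e * norm k))"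
        using Lh[OF \<open>norm h < r\<close>] err[OF \<open>norm h < r\<close>] Lh[OF \<open>norm k < r\<close>] err[OF \<open>norm k < r\<close>]
          opt'[of "a + k"]
        by (simp add: right_diff_distrib abs_le_iff)
      also have "\<dots> \<le> e * (C * \<bar>\<epsilon>\<bar>)\<^sup>2 + \<bar>\<epsilon>\<bar> * (e * (C * \<bar>\<epsilon>\<bar>)) + (e * (norm k)\<^sup>2 + \<bar>\<epsilon>\<bar> * (e * norm k))"
        using h_small \<open>e > 0\<close> by (intro add_mono mult_left_mono power_mono) auto
      also have "\<dots> = e * (M - 1) * \<bar>\<epsilon>\<bar>\<^sup>2"
        unfolding nk M_def power2_eq_square by (simp add: algebra_simps del: abs_mult_self_eq)
      also have "\<dots> \<le> e * M * \<bar>\<epsilon>\<bar>\<^sup>2"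
        using \<open>e > 0\<close> by (intro mult_right_mono mult_left_mono) auto
      also have "\<dots> \<le> c * \<eta>\<^sup>2 / 2 * \<bar>\<epsilon>\<bar>\<^sup>2"
        using e(2) by (intro mult_right_mono) auto
      finally have "(h - k) \<bullet> H (h - k) \<le> c * (\<eta> * \<bar>\<epsilon>\<bar>)\<^sup>2"
        by (simp add: power_mult_distrib)
      with c[of "h - k"] have "c * (norm (h - k))\<^sup>2 \<le> c * (\<eta> * \<bar>\<epsilon>\<bar>)\<^sup>2" by linarith
      then have "(norm (h - k))\<^sup>2 \<le> (\<eta> * \<bar>\<epsilon>\<bar>)\<^sup>2" using \<open>c > 0\<close> by simp
      then have "norm (h - k) \<le> \<eta> * \<bar>\<epsilon>\<bar>"
        by (rule power2_le_imp_le) (use \<open>\<eta> > 0\<close> in simp)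
      then show ?thesis by (simp add: h_def k_def)
    qed
    ultimately show ?thesis by blast
  qed
  then show ?thesis
    unfolding has_vector_derivative_def has_derivative_at_alt
    by (auto simp: p0 intro!: bounded_linear_minus bounded_linear_scaleR_left)
qed

section \<open>The influence formula\<close>

text \<open>The chain rule reduces the claim to the velocity of the minimizer path at zero, which is
  minus the inverse Hessian applied to the augmented gradient. \<open>\<theta>_eps\<close> is an
  arbitrary selection of minimizers in \<open>K\<close>; its continuity and differentiability at
  zero are derived.\<close>

theorem theorem3p4:
  fixes loss :: "'out \<Rightarrow> 'label \<Rightarrow> real"
    and f :: "'graph \<Rightarrow> real ^ 'p \<Rightarrow> 'out"
    and D :: "nat \<Rightarrow> 'graph \<times> 'label" and N n :: nat
    and augment :: "'graph \<times> 'label \<Rightarrow> ('graph \<times> 'label) set"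
    and z_aug z_test :: "'graph \<times> 'label"
    and \<theta>_hat :: "real ^ 'p" and \<theta>_eps :: "real \<Rightarrow> real ^ 'p"
    and K :: "(real ^ 'p) set"
  assumes n: "n \<in> {1..N}"
    and aug: "z_aug \<in> augment (D n)"
    and train_diff: "\<And>i \<theta>. i \<in> {1..N} \<Longrightarrow> sample_loss loss f (D i) differentiable (at \<theta>)"
    and aug_diff: "\<And>\<theta>. sample_loss loss f z_aug differentiable (at \<theta>)"
    and test_diff: "\<And>\<theta>. sample_loss loss f z_test differentiable (at \<theta>)"
    and twice_diff: "gradient (training_objective loss f D N) differentiable (at \<theta>_hat)"
    and hessian_inv: "invertible (hessian (training_objective loss f D N) \<theta>_hat)"
    and K: "compact K"
    and \<theta>_hat: "argmin_set (training_objective loss f D N) \<inter> K = {\<theta>_hat}"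
    and \<theta>_eps: "\<forall>\<^sub>F \<epsilon> in nhds 0.
           \<theta>_eps \<epsilon> \<in> argmin_set (upweighted_objective loss f D N z_aug \<epsilon>) \<inter> K"
  shows "((\<lambda>\<epsilon>. sample_loss loss f z_test (\<theta>_eps \<epsilon>)) has_real_derivative
           - (gradient (sample_loss loss f z_test) \<theta>_hat \<bullet>
               (matrix_inv (hessian (training_objective loss f D N) \<theta>_hat) *v
                 gradient (sample_loss loss f z_aug) \<theta>_hat))) (at 0)"
proof -
  let ?L = "training_objective loss f D N"
  let ?l = "sample_loss loss f z_aug"
  let ?H = "hessian ?L \<theta>_hat"
  define w where "w = matrix_inv ?H *v gradient ?l \<theta>_hat"
  have L_diff: "?L differentiable (at \<theta>)" for \<theta>
    unfolding training_objective_def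
    by (intro differentiable_mult differentiable_const differentiable_sum ballI train_diff) auto
  have up: "upweighted_objective loss f D N z_aug \<epsilon> = (\<lambda>\<theta>. ?L \<theta> + \<epsilon> * ?l \<theta>)" for \<epsilon>
    by (simp add: fun_eq_iff upweighted_objective_def)
  note opt = \<theta>_eps[unfolded up]
  \<comment> \<open>A property holding eventually in \<open>nhds 0\<close> holds at zero itself,
    where the upweighted objective is the training objective; uniqueness then fixes the base point
    of the path.\<close>
  have "\<theta>_eps 0 \<in> argmin_set ?L \<inter> K"
    using eventually_nhds_x_imp_x[OF opt] by simp
  then have p0: "\<theta>_eps 0 = \<theta>_hat" using \<theta>_hat by blast
  have opt_at: "\<forall>\<^sub>F \<epsilon> in at 0. \<theta>_eps \<epsilon> \<in> argmin_set (\<lambda>\<theta>. ?L \<theta> + \<epsilon> * ?l \<theta>) \<inter> K"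
    using opt by (auto simp: eventually_at_filter elim: eventually_mono)
  have cont: "continuous_on K g" if "\<And>\<theta>. g differentiable (at \<theta>)" for g :: "real ^ 'p \<Rightarrow> real"
    using that by (meson continuous_at_imp_continuous_on differentiable_imp_continuous_within)
  have "(\<theta>_eps has_vector_derivative - w) (at 0)"
  proof (rule perturbed_minimizer_has_derivative)
    show "GDERIV ?L \<theta> :> gradient ?L \<theta>" for \<theta> by (intro GDERIV_gradient L_diff)
    show "(gradient ?L has_derivative (*v) ?H) (at \<theta>_hat)"
      using twice_diff unfolding hessian_def jacobian_works .
    show "h = 0" if "?H *v h = 0" for h
      using that hessian_inv by (metis invertible_eq_bij bij_is_inj injD matrix_vector_mult_0_right)
    show "?L \<theta>_hat \<le> ?L \<theta>" for \<theta>
      using \<theta>_hat by (auto simp: argmin_set_def is_arg_min_linorder)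
    show "GDERIV ?l \<theta>_hat :> gradient ?l \<theta>_hat" by (intro GDERIV_gradient aug_diff)
    show "?H *v w = gradient ?l \<theta>_hat"
      unfolding w_def using hessian_inv by (rule matrix_inv_right_mult)
    show "\<theta>_eps 0 = \<theta>_hat" by (fact p0)
    show "(\<theta>_eps \<longlongrightarrow> \<theta>_hat) (at 0)"
      using cont[OF L_diff] cont[OF aug_diff] K \<theta>_hat opt_at tendsto_ident_at
      by (rule perturbed_minimizer_tendsto)
    show "\<forall>\<^sub>F \<epsilon> in at 0. \<forall>\<theta>. ?L (\<theta>_eps \<epsilon>) + \<epsilon> * ?l (\<theta>_eps \<epsilon>) \<le> ?L \<theta> + \<epsilon> * ?l \<theta>"
      using opt_at by eventually_elim (auto simp: argmin_set_def is_arg_min_linorder)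
  qed
  then have "(\<theta>_eps has_derivative (\<lambda>t. t *\<^sub>R (- w))) (at 0)"
    by (simp add: has_vector_derivative_def)
  moreover have "(sample_loss loss f z_test has_derivative
      (\<lambda>h. h \<bullet> gradient (sample_loss loss f z_test) \<theta>_hat)) (at (\<theta>_eps 0))"
    using GDERIV_gradient[OF test_diff] by (simp add: gderiv_def p0)
  ultimately have "((\<lambda>\<epsilon>. sample_loss loss f z_test (\<theta>_eps \<epsilon>)) has_derivative
      (\<lambda>t. t *\<^sub>R (- w) \<bullet> gradient (sample_loss loss f z_test) \<theta>_hat)) (at 0)"
    by (rule has_derivative_compose)
  then show ?thesis
    unfolding has_field_derivative_def w_def
    by (rule has_derivative_eq_rhs) (auto simp: fun_eq_iff inner_commute)
qed

end
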